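(* Let $A$ be an alphabet of constant size and $T=T[1..n]$ a string over $A$. Run the following algorithm on $T$. Create nodes $root$ and $\perp$; set $f(root)\gets\perp$; for every $a\in A$ set an $a$-edge from $\perp$ to $root$. Set $currentnode\gets root$, $currentsuffix\gets 1$. For $i=1$ to $n$: set $lastcreatednode\gets undefined$; while $currentnode$ has no outgoing $T[i]$-edge: create a new node $newnode$ storing position $currentsuffix$, set a $T[i]$-edge from $currentnode$ to $newnode$, if $lastcreatednode\ne undefined$ set $f(lastcreatednode)\gets newnode$, set $lastcreatednode\gets newnode$, $currentnode\gets f(currentnode)$, $currentsuffix\gets currentsuffix+1$. After the while loop, move $currentnode$ to the target of its outgoing $T[i]$-edge, and if $lastcreatednode\ne undefined$ set $f(lastcreatednode)\gets currentnode$. Then the algorithm constructs $\mathrm{PH}(T)$ on-line: for every $k\in\{1,\ldots,n\}$, after the $k$-th iteration of the for-loop, the trie rooted at $root$ (ignoring $\perp$), with each node storing the position assigned at its creation, is the position heap $\mathrm{PH}(T[1..k])$ with each node storing its primary position (secondary positions are not stored explicitly), and $f$ restricted to the non-root nodes is the suffix pointer function of $\mathrm{PH}(T[1..k])$. Moreover, the total running time of the algorithm is $O(n)$.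
   Context: Strings are indexed from 1; $T[i..j]=T[i]\cdots T[j]$. A trie is a rooted tree with edges directed away from the root labeled by letters, distinct letters on edges leaving the same node; a node's path label is the string read from the root to it; a string $w$ is represented if it is some node's path label, and that node is denoted $\overline{w}$. The position heap $\mathrm{PH}(S)$ of a string $S[1..m]$: start with a single root node; for $i=1,\ldots,m$ in this order insert suffix $S[i..m]$: if $S[i..m]$ is already represented, add position $i$ to node $\overline{S[i..m]}$; otherwise let $v'$ be the longest represented prefix of $S[i..m]$ and $a$ the letter following it, and create a new child of $\overline{v'}$ via an $a$-edge storing position $i$. Each node stores one or two positions; if it stores $i<j$, $i$ is its primary and $j$ its secondary position (a single stored position is primary). Suffix pointers: for each non-root node $\overline{S[i..j]}$ of $\mathrm{PH}(S)$, $f(\overline{S[i..j]})=\overline{S[i+1..j]}$ (this node always exists); by convention $f(root)=\perp$, an auxiliary node with an $a$-edge to the root for every letter $a$. Running time is measured with constant-time operations on nodes, edges and integers. *)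

theory Defs
  imports Main "HOL-Library.Monad_Syntax"
begin

section \<open>Position heaps\<close>

text \<open>
  A trie is given by its represented strings, each node being named by its path label; there is an
  \<open>a\<close>-edge from \<open>w\<close> to \<open>w @ [a]\<close> whenever both are nodes. A trie whose nodes store positions is a
  map with these strings as domain and the sets of stored positions as values. The root stores none.
\<close>

type_synonym 'a pos_trie = "'a list \<rightharpoonup> nat set"

definition longest_represented_prefix :: "'a pos_trie \<Rightarrow> 'a list \<Rightarrow> 'a list" where
  "longest_represented_prefix H w =
     take (GREATEST l. l \<le> length w \<and> take l w \<in> dom H) w"

definition insert_suffix :: "nat \<Rightarrow> 'a list \<Rightarrow> 'a pos_trie \<Rightarrow> 'a pos_trie" where
  "insert_suffix i w H =
     (case H w of
        Some P \<Rightarrow> H(w \<mapsto> insert i P)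
      | None \<Rightarrow> (let v = longest_represented_prefix H w
                 in H(v @ [w ! length v] \<mapsto> {i})))"

text \<open>Positions are counted from 1, so the suffix at position \<open>i\<close> is \<open>drop (i - 1) S\<close>.\<close>

definition position_heap :: "'a list \<Rightarrow> 'a pos_trie" where
  "position_heap S =
     fold (\<lambda>i. insert_suffix i (drop (i - 1) S)) [1..<length S + 1] [[] \<mapsto> {}]"

definition primary_position :: "nat set \<Rightarrow> nat option" where
  "primary_position P = (if P = {} then None else Some (Min P))"


section \<open>A small imperative language with running times\<close>

text \<open>
  A primitive statement is a partial state transformer: where it is undefined (for instance when an
  undefined pointer is dereferenced) execution is stuck. Every primitive statement and every
  evaluation of a condition takes one time unit.
\<close>

datatype 's com =
    Skip
  | Prim "'s \<Rightarrow> 's option"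
  | Seq "'s com" "'s com"  (infixr \<open>;;\<close> 60)
  | Cond "'s \<Rightarrow> bool" "'s com" "'s com"
  | While "'s \<Rightarrow> bool" "'s com"

inductive exec :: "'s com \<Rightarrow> 's \<Rightarrow> nat \<Rightarrow> 's \<Rightarrow> bool" where
  Skip: "exec Skip s 0 s"
| Prim: "p s = Some s' \<Longrightarrow> exec (Prim p) s 1 s'"
| Seq: "\<lbrakk>exec c s t s'; exec d s' t' s''\<rbrakk> \<Longrightarrow> exec (c ;; d) s (t + t') s''"
| CondTrue: "\<lbrakk>b s; exec c s t s'\<rbrakk> \<Longrightarrow> exec (Cond b c d) s (1 + t) s'"
| CondFalse: "\<lbrakk>\<not> b s; exec d s t s'\<rbrakk> \<Longrightarrow> exec (Cond b c d) s (1 + t) s'"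
| WhileFalse: "\<not> b s \<Longrightarrow> exec (While b c) s 1 s"
| WhileTrue: "\<lbrakk>b s; exec c s t s'; exec (While b c) s' t' s''\<rbrakk>
              \<Longrightarrow> exec (While b c) s (1 + t + t') s''"


section \<open>The on-line construction\<close>

type_synonym node = nat

text \<open>
  The created nodes are those below \<open>next_node\<close>. Pointer variables hold \<open>None\<close> when undefined.
\<close>

record 'a state =
  next_node :: node
  edge :: "node \<times> 'a \<rightharpoonup> node"
  suffix_pointer :: "node \<rightharpoonup> node"
  stored :: "node \<rightharpoonup> nat"
  root_node :: "node option"
  bot_node :: "node option"
  currentnode :: "node option"
  newnode :: "node option"
  lastcreatednode :: "node option"
  currentsuffix :: nat

definition start_state :: "'a state" where
  "start_state =
     \<lparr>next_node = 0, edge = Map.empty, suffix_pointer = Map.empty, stored = Map.empty,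
      root_node = None, bot_node = None, currentnode = None, newnode = None,
      lastcreatednode = None, currentsuffix = 0\<rparr>"

definition initialize :: "'a list \<Rightarrow> 'a state com" where
  "initialize letters =
     Prim (\<lambda>s. Some (s\<lparr>root_node := Some (next_node s), next_node := next_node s + 1\<rparr>)) ;;
     Prim (\<lambda>s. Some (s\<lparr>bot_node := Some (next_node s), next_node := next_node s + 1\<rparr>)) ;;
     Prim (\<lambda>s. do {r \<leftarrow> root_node s; b \<leftarrow> bot_node s;
                   Some (s\<lparr>suffix_pointer := (suffix_pointer s)(r \<mapsto> b)\<rparr>)}) ;;
     foldr (;;)
       (map (\<lambda>a. Prim (\<lambda>s. do {r \<leftarrow> root_node s; b \<leftarrow> bot_node s;
                               Some (s\<lparr>edge := (edge s)((b, a) \<mapsto> r)\<rparr>)})) letters)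
       Skip ;;
     Prim (\<lambda>s. do {r \<leftarrow> root_node s; Some (s\<lparr>currentnode := Some r\<rparr>)}) ;;
     Prim (\<lambda>s. Some (s\<lparr>currentsuffix := 1\<rparr>))"

definition lacks_edge :: "'a \<Rightarrow> 'a state \<Rightarrow> bool" where
  "lacks_edge a s \<longleftrightarrow> (\<exists>v. currentnode s = Some v \<and> edge s (v, a) = None)"

definition while_body :: "'a \<Rightarrow> 'a state com" where
  "while_body a =
     Prim (\<lambda>s. Some (s\<lparr>newnode := Some (next_node s), next_node := next_node s + 1\<rparr>)) ;;
     Prim (\<lambda>s. do {x \<leftarrow> newnode s;
                   Some (s\<lparr>stored := (stored s)(x \<mapsto> currentsuffix s)\<rparr>)}) ;;
     Prim (\<lambda>s. do {v \<leftarrow> currentnode s; x \<leftarrow> newnode s;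
                   Some (s\<lparr>edge := (edge s)((v, a) \<mapsto> x)\<rparr>)}) ;;
     Cond (\<lambda>s. lastcreatednode s \<noteq> None)
       (Prim (\<lambda>s. do {l \<leftarrow> lastcreatednode s; x \<leftarrow> newnode s;
                      Some (s\<lparr>suffix_pointer := (suffix_pointer s)(l \<mapsto> x)\<rparr>)}))
       Skip ;;
     Prim (\<lambda>s. do {x \<leftarrow> newnode s; Some (s\<lparr>lastcreatednode := Some x\<rparr>)}) ;;
     Prim (\<lambda>s. do {v \<leftarrow> currentnode s; u \<leftarrow> suffix_pointer s v;
                   Some (s\<lparr>currentnode := Some u\<rparr>)}) ;;
     Prim (\<lambda>s. Some (s\<lparr>currentsuffix := currentsuffix s + 1\<rparr>))"

definition for_body :: "'a \<Rightarrow> 'a state com" where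
  "for_body a =
     Prim (\<lambda>s. Some (s\<lparr>lastcreatednode := None\<rparr>)) ;;
     While (lacks_edge a) (while_body a) ;;
     Prim (\<lambda>s. do {v \<leftarrow> currentnode s; u \<leftarrow> edge s (v, a);
                   Some (s\<lparr>currentnode := Some u\<rparr>)}) ;;
     Cond (\<lambda>s. lastcreatednode s \<noteq> None)
       (Prim (\<lambda>s. do {l \<leftarrow> lastcreatednode s; v \<leftarrow> currentnode s;
                      Some (s\<lparr>suffix_pointer := (suffix_pointer s)(l \<mapsto> v)\<rparr>)}))
       Skip"

text \<open>
  \<open>after_iteration letters T k t s\<close>: the run on \<open>T\<close> reaches state \<open>s\<close> at time \<open>t\<close>, immediately
  after the \<open>k\<close>-th iteration of the for-loop (for \<open>k = 0\<close>: after the initialization). The list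
  \<open>letters\<close> enumerates the alphabet. The control of the for-loop takes one time unit per iteration,
  and one more unit to leave the loop.
\<close>

inductive after_iteration :: "'a list \<Rightarrow> 'a list \<Rightarrow> nat \<Rightarrow> nat \<Rightarrow> 'a state \<Rightarrow> bool"
  for letters T where
  "exec (initialize letters) start_state t s \<Longrightarrow> after_iteration letters T 0 t s"
| "\<lbrakk>after_iteration letters T k t s; k < length T; exec (for_body (T ! k)) s t' s'\<rbrakk>
   \<Longrightarrow> after_iteration letters T (k + 1) (t + 1 + t') s'"

definition halts_after :: "'a list \<Rightarrow> 'a list \<Rightarrow> nat \<Rightarrow> bool" where
  "halts_after letters T t \<longleftrightarrow> (\<exists>t' s. after_iteration letters T (length T) t' s \<and> t = t' + 1)"


section \<open>Correctness of a state\<close>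

text \<open>
  The trie held in the state is compared with \<open>position_heap S\<close> by the isomorphism \<open>\<phi>\<close> that sends a
  node to its path label; the suffix pointer of the node with path label \<open>w\<close> leads to the
  node with path label \<open>tl w\<close>.
\<close>

definition represents_position_heap :: "'a state \<Rightarrow> 'a list \<Rightarrow> bool" where
  "represents_position_heap s S \<longleftrightarrow>
     (\<exists>r b N \<phi>.
        root_node s = Some r \<and> bot_node s = Some b \<and>
        N = {v. v < next_node s} - {b} \<and> r \<in> N \<and>
        bij_betw \<phi> N (dom (position_heap S)) \<and> \<phi> r = [] \<and>
        (\<forall>u\<in>N. \<forall>a v. edge s (u, a) = Some v \<longleftrightarrow> v \<in> N \<and> \<phi> v = \<phi> u @ [a]) \<and>
        (\<forall>v\<in>N. stored s v = primary_position (the (position_heap S (\<phi> v)))) \<and>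
        (\<forall>v\<in>N - {r}. \<exists>u\<in>N. suffix_pointer s v = Some u \<and> \<phi> u = tl (\<phi> v)))"

end

theory Submission imports Defs begin

text \<open>
  Inserting the suffixes of \<open>S\<close> in order, the first \<open>q\<close> of them create a node each and all later
  ones are already represented, since the set of nodes is closed under deleting the first letter.
  If a suffix of \<open>S\<close> creates a node, then the same suffix of \<open>S @ [a]\<close> creates the same node; hence
  the heap of \<open>S @ [a]\<close> arises from that of \<open>S\<close> by creating the nodes \<open>drop i S @ [a]\<close> for
  \<open>i = q, q + 1, \<dots>\<close> until one of them is already represented, and these suffixes \<open>drop i S\<close> are
  visited by following suffix pointers. Each execution of the while loop increases \<open>q\<close>, which never
  exceeds the number of letters read; this gives the linear running time.
\<close>

lemma tl_drop_pred: "0 < n \<Longrightarrow> tl (drop (n - 1) xs) = drop n xs"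
  by (cases n) (simp_all add: drop_Suc tl_drop)


section \<open>Position heaps of growing strings\<close>

text \<open>By prefix-closedness, one unrepresented prefix makes all longer prefixes unrepresented.
  So \<open>l\<close> is the greatest length of a represented prefix, and the \<open>None\<close>
  branch of the insertion applies.\<close>

lemma insert_suffix_new:
  assumes prefix_closed: "\<And>u v. u @ v \<in> dom H \<Longrightarrow> u \<in> dom H"
    and l: "l < length w" "take l w \<in> dom H" "take (Suc l) w \<notin> dom H"
  shows "insert_suffix i w H = H(take (Suc l) w \<mapsto> {i})"
proof -
  have long: "take m w \<notin> dom H" if "l < m" for m
  proof
    assume "take m w \<in> dom H"
    moreover have "take m w = take (Suc l) w @ drop (Suc l) (take m w)"
      using that by (metis Suc_leI append_take_drop_id min.absorb1 take_take)
    ultimately show False using prefix_closed l(3) by metis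
  qed
  then have "H w = None" using l(1) by (metis domIff take_all_iff order_refl)
  moreover have "(GREATEST m. m \<le> length w \<and> take m w \<in> dom H) = l"
    using l long by (intro Greatest_equality) (auto simp: not_less[symmetric])
  ultimately show ?thesis
    using l(1) by (simp add: insert_suffix_def longest_represented_prefix_def
        take_Suc_conv_app_nth Let_def)
qed

lemma insert_suffix_represented:
  "H w = Some P \<Longrightarrow> insert_suffix i w H = H(w \<mapsto> insert i P)"
  by (simp add: insert_suffix_def)

text \<open>
  \<open>created S q H\<close>: each of the first \<open>q\<close> insertions for \<open>S\<close> creates a node, and \<open>H\<close> is the result.
\<close>

inductive created :: "'a list \<Rightarrow> nat \<Rightarrow> 'a pos_trie \<Rightarrow> bool" for S where
  created_0: "created S 0 [[] \<mapsto> {}]"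
| created_Suc: "\<lbrakk>created S i H; l < length (drop i S); take l (drop i S) \<in> dom H;
    take (Suc l) (drop i S) \<notin> dom H\<rbrakk>
   \<Longrightarrow> created S (Suc i) (H(take (Suc l) (drop i S) \<mapsto> {Suc i}))"

text \<open>A new node extends the existing node \<open>take l (drop i S)\<close> by one letter, so
  its proper prefixes are prefixes of that parent.\<close>

lemma created_prefix: "created S q H \<Longrightarrow> u @ v \<in> dom H \<Longrightarrow> u \<in> dom H"
proof (induction arbitrary: v rule: created.induct)
  case created_0
  then show ?case by (auto split: if_splits)
next
  case (created_Suc i H l)
  let ?w = "take (Suc l) (drop i S)"
  show ?case
  proof (cases "u @ v = ?w \<and> v \<noteq> []")
    case True
    then have "u @ butlast v = take l (drop i S)"
      using created_Suc.hyps(2) by (metis butlast_append butlast_take diff_Suc_1 Suc_leI)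
    then have "u \<in> dom H" using created_Suc.IH created_Suc.hyps(3) by metis
    then show ?thesis by (simp del: fun_upd_apply)
  next
    case False
    then consider "u = ?w" | "u @ v \<in> dom H" using created_Suc.prems
      by (auto simp del: fun_upd_apply)
    then show ?thesis using created_Suc.IH by cases (auto simp del: fun_upd_apply)
  qed
qed

text \<open>Each step writes outside the current domain, so no node is assigned twice. The bound
  \<open>q\<close> ensures that any later position is larger than the stored one.\<close>

lemma created_stored:
  "created S q H \<Longrightarrow> w \<noteq> [] \<Longrightarrow> H w = Some P \<Longrightarrow> \<exists>j\<le>q. P = {j}"
proof (induction rule: created.induct)
  case (created_Suc i H l)
  then show ?case by (cases "w = take (Suc l) (drop i S)") (auto intro: le_SucI)
qed (auto split: if_splits)

text \<open>A creating step reads only the first \<open>Suc l\<close> letters of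
  \<open>drop i S\<close>, all of which lie inside \<open>S\<close>; appended letters cannot affect
  it. This is what makes the construction on-line.\<close>

lemma created_append: "created S q H \<Longrightarrow> created (S @ x) q H"
proof (induction rule: created.induct)
  case (created_Suc i H l)
  then show ?case using created.created_Suc[of "S @ x" i H l] by (simp del: fun_upd_apply)
qed (rule created.created_0)

lemma created_fold:
  "created S q H \<Longrightarrow>
   fold (\<lambda>i. insert_suffix i (drop (i - 1) S)) [1..<q + 1] [[] \<mapsto> {}] = H"
proof (induction rule: created.induct)
  case (created_Suc i H l)
  then show ?case by (simp add: insert_suffix_new[OF created_prefix])
qed simp

text \<open>Since \<open>drop q S\<close> is represented and tails of nodes are nodes, every later
  suffix is represented too. The remaining insertions therefore add no nodes, only positions greater
  than \<open>q\<close>, and these leave each minimum unchanged.\<close>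

lemma position_heap_of_created:
  assumes created: "created S q H" and "q \<le> length S" and represented: "drop q S \<in> dom H"
    and tl_closed: "\<And>w. w \<in> dom H \<Longrightarrow> tl w \<in> dom H"
  shows "dom (position_heap S) = dom H"
    and "w \<in> dom H \<Longrightarrow>
      primary_position (the (position_heap S w)) = primary_position (the (H w))"
proof -
  define G where
    "G n = fold (\<lambda>i. insert_suffix i (drop (i - 1) S)) [1..<n + 1] [[] \<mapsto> {}]" for n
  have drop_dom: "drop n S \<in> dom H" if "q \<le> n" for n
    using that
  proof (induction rule: dec_induct)
    case (step n)
    then show ?case using tl_closed[of "drop n S"] by (simp only: drop_Suc tl_drop)
  qed (rule represented)
  \<comment> \<open>\<open>Q\<close> collects the positions added after the first \<open>q\<close>
    insertions. It stays empty at the root, because only nonempty suffixes are inserted; otherwise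
    the root would acquire a primary position.\<close>
  have G: "dom (G n) = dom H \<and> (\<forall>w\<in>dom H. \<exists>Q. G n w = Some (the (H w) \<union> Q) \<and> finite Q \<and>
      (w = [] \<longrightarrow> Q = {}) \<and> (\<forall>j\<in>Q. q < j))" if "q \<le> n" "n \<le> length S" for n
    using that
  proof (induction rule: dec_induct)
    case base
    have "G q = H" using created_fold[OF created] by (simp add: G_def)
    then show ?case by (auto intro: exI[of _ "{}"])
  next
    case (step n)
    let ?w = "drop n S"
    obtain P where P: "G n ?w = Some P" using step drop_dom[of n] by (metis Suc_leD domD)
    have "G (Suc n) = insert_suffix (Suc n) ?w (G n)" by (simp add: G_def)
    then have upd: "G (Suc n) = (G n)(?w \<mapsto> insert (Suc n) P)"
      using insert_suffix_represented[of "G n", OF P] by simp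
    have "?w \<noteq> []" using step.prems by simp
    have "\<exists>Q. G (Suc n) w = Some (the (H w) \<union> Q) \<and> finite Q \<and>
        (w = [] \<longrightarrow> Q = {}) \<and> (\<forall>j\<in>Q. q < j)" if w: "w \<in> dom H" for w
    proof -
      obtain Q where Q: "G n w = Some (the (H w) \<union> Q)" "finite Q" "w = [] \<longrightarrow> Q = {}"
        "\<forall>j\<in>Q. q < j" using step w by (meson Suc_leD)
      show ?thesis
      proof (cases "w = ?w")
        case True
        then show ?thesis
          using Q P upd \<open>?w \<noteq> []\<close> step.hyps by (intro exI[of _ "insert (Suc n) Q"]) auto
      next
        case False
        then show ?thesis using Q upd by (intro exI[of _ Q]) auto
      qed
    qed
    moreover have "dom (G (Suc n)) = dom H"
      using upd step drop_dom[of n] by (simp add: insert_absorb)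
    ultimately show ?case by blast
  qed
  have eq: "position_heap S = G (length S)" by (simp add: position_heap_def G_def)
  show "dom (position_heap S) = dom H" using G[of "length S"] assms(2) eq by simp
  assume w: "w \<in> dom H"
  then obtain Q where Q: "position_heap S w = Some (the (H w) \<union> Q)" "finite Q"
    "w = [] \<longrightarrow> Q = {}" "\<forall>j\<in>Q. q < j"
    using G[of "length S"] assms(2) eq by (metis order_refl)
  show "primary_position (the (position_heap S w)) = primary_position (the (H w))"
  proof (cases "w = []")
    case True
    then show ?thesis using Q by simp
  next
    case False
    then obtain j where j: "the (H w) = {j}" "j \<le> q"
      using created_stored[OF created False] w by force
    then have "Min ({j} \<union> Q) = j" using Q by (intro Min_eqI) force+
    then show ?thesis using Q j by (simp add: primary_position_def)
  qed
qed


section \<open>Executions\<close>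

text \<open>The theorem speaks about all runs, whereas the invariant is established for one
  constructed run; determinism of both final state and time bridges the two.\<close>

lemma exec_deterministic: "exec c s t s' \<Longrightarrow> exec c s u s'' \<Longrightarrow> u = t \<and> s'' = s'"
proof (induction arbitrary: u s'' rule: exec.induct)
  case (Skip s)
  then show ?case by (auto elim: exec.cases)
next
  case (Prim p s s')
  from Prim(2,1) show ?case by cases auto
next
  case (Seq c s t s' d t' s'')
  from Seq.prems show ?case by cases (use Seq.IH in blast)
next
  case (CondTrue b s c t s' d)
  from CondTrue.prems show ?case by cases (use CondTrue.hyps CondTrue.IH in blast)+
next
  case (CondFalse b s d t s' c)
  from CondFalse.prems show ?case by cases (use CondFalse.hyps CondFalse.IH in blast)+
next
  case (WhileFalse b s c)
  from WhileFalse.prems show ?case by cases (use WhileFalse.hyps in blast)+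
next
  case (WhileTrue b s c t s' t' s'')
  from WhileTrue.prems show ?case by cases (use WhileTrue.hyps WhileTrue.IH in blast)+
qed

lemma after_iteration_deterministic:
  "after_iteration letters T k t s \<Longrightarrow> after_iteration letters T k u s' \<Longrightarrow> u = t \<and> s' = s"
proof (induction arbitrary: u s' rule: after_iteration.induct)
  case (1 t s)
  from 1(2) show ?case by cases (use exec_deterministic[OF 1(1)] in auto)
next
  case (2 k t s t' s' u s'a)
  note IH = 2(4) and step = 2(3)
  from 2(5) show ?case
  proof cases
    case (2 k' u' s1 t1)
    then have "after_iteration letters T k u' s1" and run: "exec (for_body (T ! k)) s1 t1 s'a"
      by auto
    then have "u' = t" "s1 = s" using IH by auto
    then show ?thesis using 2 run exec_deterministic[OF step] by auto
  qed simp
qed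

text \<open>With the time in the form \<open>Suc t\<close>, a sequence of primitives can be run by
  resolution against an explicit tower of successors.\<close>

lemma exec_Prim_Seq: "p s = Some s' \<Longrightarrow> exec d s' t s'' \<Longrightarrow> exec (Prim p ;; d) s (Suc t) s''"
  using exec.Seq[OF exec.Prim] by fastforce

lemma exec_Prim: "p s = Some s' \<Longrightarrow> exec (Prim p) s (Suc 0) s'"
  using exec.Prim by fastforce


section \<open>The invariant\<close>

text \<open>This is the set \<open>N\<close> of \<open>represents_position_heap\<close>, with
  \<bottom> fixed as the second node that \<open>initialize\<close> creates.\<close>

definition nodes :: "'a state \<Rightarrow> node set" where
  "nodes s = {v. v < next_node s} - {1}"

text \<open>
  The root is node 0 and \<open>\<bottom>\<close> is node 1. The suffix pointer of the node \<open>X\<close>, if any, has not been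
  set yet.
\<close>

definition trie_inv ::
  "'a set \<Rightarrow> 'a list \<Rightarrow> nat \<Rightarrow> 'a pos_trie \<Rightarrow> (node \<Rightarrow> 'a list) \<Rightarrow> node option \<Rightarrow> 'a state \<Rightarrow> bool"
  where
  "trie_inv A S q H \<phi> X s \<longleftrightarrow>
     created S q H \<and> currentsuffix s = Suc q \<and>
     root_node s = Some 0 \<and> bot_node s = Some 1 \<and> 2 \<le> next_node s \<and>
     bij_betw \<phi> (nodes s) (dom H) \<and> \<phi> 0 = [] \<and>
     (\<forall>u\<in>nodes s. \<forall>a v. edge s (u, a) = Some v \<longleftrightarrow> v \<in> nodes s \<and> \<phi> v = \<phi> u @ [a]) \<and>
     (\<forall>a\<in>A. edge s (1, a) = Some 0) \<and>
     (\<forall>u a. next_node s \<le> u \<longrightarrow> edge s (u, a) = None) \<and>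
     (\<forall>v\<in>nodes s. stored s v = primary_position (the (H (\<phi> v)))) \<and>
     suffix_pointer s 0 = Some 1 \<and>
     (\<forall>v\<in>nodes s - {0}. X \<noteq> Some v \<longrightarrow>
        (\<exists>u\<in>nodes s. suffix_pointer s v = Some u \<and> \<phi> u = tl (\<phi> v)))"

text \<open>The current node is the active one: \<open>drop q S\<close> is the longest suffix whose
  insertion creates no node, and it is empty if every insertion creates one. The argument
  \<open>None\<close> says that no suffix pointer is pending.\<close>

definition for_inv :: "'a set \<Rightarrow> 'a list \<Rightarrow> nat \<Rightarrow> 'a state \<Rightarrow> bool" where
  "for_inv A S q s \<longleftrightarrow> q \<le> length S \<and>
     (\<exists>H \<phi>. trie_inv A S q H \<phi> None s \<and>
        (\<exists>v\<in>nodes s. currentnode s = Some v \<and> \<phi> v = drop q S))"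

text \<open>The trie already counts creations for \<open>S @ [a]\<close>, while the current node is
  still located in terms of \<open>S\<close>, since \<open>a\<close> is not yet consumed. The value
  \<open>q = Suc (length S)\<close> means that even the suffix \<open>[a]\<close> got its own node;
  the current node is then \<bottom>.\<close>

definition while_inv :: "'a set \<Rightarrow> 'a list \<Rightarrow> 'a \<Rightarrow> nat \<Rightarrow> 'a state \<Rightarrow> bool" where
  "while_inv A S a q s \<longleftrightarrow> q \<le> Suc (length S) \<and>
     (\<exists>H \<phi>. trie_inv A (S @ [a]) q H \<phi> (lastcreatednode s) s \<and>
        (if q \<le> length S then \<exists>v\<in>nodes s. currentnode s = Some v \<and> \<phi> v = drop q S
         else currentnode s = Some 1) \<and>
        (\<forall>l. lastcreatednode s = Some l \<longrightarrow>
           l \<in> nodes s \<and> 0 < q \<and> \<phi> l = drop (q - 1) S @ [a]))"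

section \<open>From the invariant to the position heap\<close>

text \<open>The suffix pointers witness closure under tails, and the current node witnesses that
  \<open>drop q S\<close> is represented; these are the premises of
  \<open>position_heap_of_created\<close>.\<close>

lemma for_inv_represents:
  assumes "for_inv A S q s"
  shows "represents_position_heap s S"
proof -
  obtain H \<phi> v where inv: "trie_inv A S q H \<phi> None s" and q: "q \<le> length S"
    and v: "v \<in> nodes s" "\<phi> v = drop q S"
    using assms by (auto simp: for_inv_def)
  have bij: "bij_betw \<phi> (nodes s) (dom H)" and cr: "created S q H"
    using inv by (auto simp: trie_inv_def)
  have "tl w \<in> dom H" if w: "w \<in> dom H" for w
  proof -
    obtain x where x: "x \<in> nodes s" "\<phi> x = w" using bij w by (metis bij_betw_imp_surj_on imageE)
    show ?thesis
    proof (cases "x = 0")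
      case True
      then show ?thesis using x inv w by (auto simp: trie_inv_def)
    next
      case False
      then obtain u where "u \<in> nodes s" "\<phi> u = tl w"
        using x inv unfolding trie_inv_def by blast
      then show ?thesis using bij by (metis bij_betwE)
    qed
  qed
  moreover have "drop q S \<in> dom H" using v bij by (metis bij_betwE)
  ultimately have heap: "dom (position_heap S) = dom H"
    "\<And>w. w \<in> dom H \<Longrightarrow>
      primary_position (the (position_heap S w)) = primary_position (the (H w))"
    using position_heap_of_created[OF cr q] by blast+
  have stored: "stored s x = primary_position (the (position_heap S (\<phi> x)))" if "x \<in> nodes s" for x
  proof -
    have "\<phi> x \<in> dom H" using bij that by (metis bij_betwE)
    then show ?thesis using heap(2) inv that unfolding trie_inv_def by simp
  qed
  have "0 \<in> nodes s" using inv by (auto simp: trie_inv_def nodes_def)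
  moreover have "\<forall>v\<in>nodes s - {0}. \<exists>u\<in>nodes s. suffix_pointer s v = Some u \<and> \<phi> u = tl (\<phi> v)"
    "\<forall>u\<in>nodes s. \<forall>a v. edge s (u, a) = Some v \<longleftrightarrow> v \<in> nodes s \<and> \<phi> v = \<phi> u @ [a]"
    "root_node s = Some 0" "bot_node s = Some 1" "\<phi> 0 = []"
    using inv unfolding trie_inv_def by simp_all
  moreover have "\<forall>x\<in>nodes s. stored s x = primary_position (the (position_heap S (\<phi> x)))"
    using stored by blast
  moreover have "nodes s = {v. v < next_node s} - {1}" by (rule nodes_def)
  ultimately show ?thesis
    unfolding represents_position_heap_def heap(1) using bij
    by (intro exI[of _ "0::nat"] exI[of _ "1::nat"] exI[of _ "nodes s"] exI[of _ \<phi>] conjI) assumption+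
qed

section \<open>The while loop: creating nodes along suffix pointers\<close>

text \<open>The missing edge means that \<open>drop q S @ [a]\<close> is not represented although
  \<open>drop q S\<close> is, so the insertion of this suffix creates exactly the node made here.
  The bound 8 counts seven primitive statements and one test.\<close>

lemma while_body_step:
  assumes inv: "while_inv A S a q s" and lacks: "lacks_edge a s" and a: "a \<in> A"
  shows "\<exists>t s'. exec (while_body a) s t s' \<and> t \<le> 8 \<and> while_inv A S a (Suc q) s'"
proof -
  obtain H \<phi> where tr: "trie_inv A (S @ [a]) q H \<phi> (lastcreatednode s) s"
    and cur: "if q \<le> length S then \<exists>v\<in>nodes s. currentnode s = Some v \<and> \<phi> v = drop q S
         else currentnode s = Some 1"
    and last: "\<And>l. lastcreatednode s = Some l \<Longrightarrow>
       l \<in> nodes s \<and> 0 < q \<and> \<phi> l = drop (q - 1) S @ [a]"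
    using inv unfolding while_inv_def by blast
  \<comment> \<open>At \<bottom> every letter of \<open>A\<close> has an edge, so the loop body is
    never entered there.\<close>
  have q: "q \<le> length S"
    using lacks cur tr a by (auto simp: lacks_edge_def trie_inv_def split: if_splits)
  then obtain v where v: "v \<in> nodes s" "currentnode s = Some v" "\<phi> v = drop q S"
    using cur by auto
  have no_edge: "edge s (v, a) = None" using lacks v by (auto simp: lacks_edge_def)
  have bij: "bij_betw \<phi> (nodes s) (dom H)" and cr: "created (S @ [a]) q H"
    and edges: "\<And>u a v. u \<in> nodes s \<Longrightarrow>
      edge s (u, a) = Some v \<longleftrightarrow> v \<in> nodes s \<and> \<phi> v = \<phi> u @ [a]"
    using tr by (auto simp: trie_inv_def)
  define n where "n = next_node s"
  define w where "w = drop q S @ [a]"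
  have n: "n \<notin> nodes s" "2 \<le> n" using tr by (auto simp: n_def nodes_def trie_inv_def)
  have w_new: "w \<notin> dom H"
  proof
    assume "w \<in> dom H"
    then obtain x where "x \<in> nodes s" "\<phi> x = w" using bij by (metis bij_betw_imp_surj_on imageE)
    then show False using edges[OF v(1), of a x] v(3) no_edge by (simp add: w_def)
  qed
  \<comment> \<open>The path labels differ in length by two. Hence the pointer of \<open>v\<close>
    is not the pending one and can be followed.\<close>
  have v_last: "lastcreatednode s \<noteq> Some v" using last v(3) q by (auto dest!: arg_cong[of _ _ length])
  \<comment> \<open>The pointer leads to \<bottom> exactly when \<open>v\<close> is the root, that
    is, when \<open>q = length S\<close>; injectivity of \<open>\<phi>\<close> excludes an empty
    label elsewhere.\<close>
  obtain u where u: "suffix_pointer s v = Some u"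
    "if Suc q \<le> length S then u \<in> nodes s \<and> \<phi> u = drop (Suc q) S else u = 1"
  proof (cases "v = 0")
    case True
    then have "suffix_pointer s v = Some 1" "q = length S"
      using tr v(3) q by (auto simp: trie_inv_def)
    then show ?thesis using that by simp
  next
    case False
    then obtain u where u: "u \<in> nodes s" "suffix_pointer s v = Some u" "\<phi> u = tl (drop q S)"
      using tr v v_last unfolding trie_inv_def by (metis DiffI singletonD)
    have "drop q S \<noteq> []"
    proof
      assume "drop q S = []"
      then have "\<phi> v = \<phi> 0" using v(3) tr by (simp add: trie_inv_def)
      moreover have "0 \<in> nodes s" using tr by (auto simp: trie_inv_def nodes_def)
      ultimately show False using bij v(1) False by (metis bij_betw_imp_inj_on inj_onD)
    qed
    then show ?thesis using that u by (simp add: drop_Suc tl_drop)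
  qed
  define sp where "sp = (case lastcreatednode s of None \<Rightarrow> suffix_pointer s
    | Some l \<Rightarrow> (suffix_pointer s)(l \<mapsto> n))"
  define s' where "s' = s\<lparr>newnode := Some n, next_node := n + 1,
    stored := (stored s)(n \<mapsto> currentsuffix s), edge := (edge s)((v, a) \<mapsto> n),
    suffix_pointer := sp, lastcreatednode := Some n, currentnode := Some u,
    currentsuffix := currentsuffix s + 1\<rparr>"
  have sp_v: "sp v = Some u" using u(1) v_last by (auto simp: sp_def split: option.splits)
  have ex: "\<exists>t. exec (while_body a) s t s' \<and> t \<le> 8"
  proof (cases "lastcreatednode s")
    case None
    \<comment> \<open>The time has the shape that the rules produce; the summand
      \<open>1 + 0\<close> is the conditional whose test fails.\<close>
    have "exec (while_body a) s (Suc (Suc (Suc (1 + 0 + Suc (Suc (Suc 0)))))) s'"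
      unfolding while_body_def
      by (rule exec_Prim_Seq, simp, rule exec_Prim_Seq, simp, rule exec_Prim_Seq,
          use v in simp, rule exec.Seq, rule exec.CondFalse, use None in simp, rule exec.Skip,
          rule exec_Prim_Seq, simp, rule exec_Prim_Seq, use v None sp_v in \<open>simp add: sp_def\<close>,
          rule exec_Prim)
        (use None in \<open>simp add: s'_def n_def sp_def\<close>)
    then show ?thesis by (intro exI conjI) auto
  next
    case (Some l)
    have "exec (while_body a) s (Suc (Suc (Suc (1 + Suc 0 + Suc (Suc (Suc 0)))))) s'"
      unfolding while_body_def
      by (rule exec_Prim_Seq, simp, rule exec_Prim_Seq, simp, rule exec_Prim_Seq,
          use v in simp, rule exec.Seq, rule exec.CondTrue, use Some in simp, rule exec_Prim,
          use Some in simp, rule exec_Prim_Seq, simp, rule exec_Prim_Seq,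
          use v u v_last Some in \<open>simp add: sp_def\<close>, rule exec_Prim)
        (use Some in \<open>simp add: s'_def n_def sp_def\<close>)
    then show ?thesis by (intro exI conjI) auto
  qed
  define H' where "H' = H(w \<mapsto> {Suc q})"
  define \<phi>' where "\<phi>' = \<phi>(n := w)"
  have nodes': "nodes s' = insert n (nodes s)"
    using n by (auto simp: nodes_def s'_def n_def)
  have s'_sel: "next_node s' = Suc n" "stored s' = (stored s)(n \<mapsto> currentsuffix s)"
    "edge s' = (edge s)((v, a) \<mapsto> n)" "suffix_pointer s' = sp" "lastcreatednode s' = Some n"
    "currentnode s' = Some u" "currentsuffix s' = Suc (currentsuffix s)"
    "root_node s' = root_node s" "bot_node s' = bot_node s"
    by (simp_all add: s'_def)
  have \<phi>'_old: "\<phi>' x = \<phi> x" if "x \<in> nodes s" for x using that n by (auto simp: \<phi>'_def)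
  have \<phi>_dom: "\<phi> x \<in> dom H" if "x \<in> nodes s" for x using bij that by (metis bij_betwE)
  \<comment> \<open>The longest represented prefix of the suffix \<open>w\<close> is all of it
    except the final \<open>a\<close>, so \<open>l\<close> is the length of
    \<open>drop q S\<close>.\<close>
  have cr': "created (S @ [a]) (Suc q) H'"
  proof -
    have "drop q S \<in> dom H" using \<phi>_dom[OF v(1)] v(3) by simp
    moreover have "take (length (drop q S)) (drop q (S @ [a])) = drop q S"
      "take (Suc (length (drop q S))) (drop q (S @ [a])) = w"
      "length (drop q S) < length (drop q (S @ [a]))" using q by (auto simp: w_def)
    ultimately show ?thesis
      using created_Suc[OF cr, of "length (drop q S)"] w_new unfolding H'_def by metis
  qed
  have bij': "bij_betw \<phi>' (nodes s') (dom H')"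
  proof -
    have "bij_betw \<phi>' (nodes s) (dom H)" using bij \<phi>'_old by (metis bij_betw_cong)
    then show ?thesis
      using notIn_Un_bij_betw[of n "nodes s" \<phi>' "dom H"] n w_new
      by (simp add: nodes' H'_def \<phi>'_def)
  qed
  have edges': "edge s' (x, c) = Some y \<longleftrightarrow> y \<in> nodes s' \<and> \<phi>' y = \<phi>' x @ [c]"
    if x: "x \<in> nodes s'" for x c y
  proof (cases "x = n")
    case True
    \<comment> \<open>The new node is a leaf: by prefix-closedness, a represented extension of
      \<open>w\<close> would make \<open>w\<close> represented before its creation.\<close>
    have no: "\<phi>' y \<noteq> w @ [c]" if y: "y \<in> nodes s'"
    proof (cases "y = n")
      case False
      then show ?thesis using y \<phi>'_old \<phi>_dom created_prefix[OF cr, of w "[c]"] w_new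
        by (metis insertE nodes')
    qed (simp add: \<phi>'_def)
    \<comment> \<open>A fresh node carries no stale edges, by the invariant's clause on nodes not
      yet created.\<close>
    have "edge s (n, c) = None" using tr by (simp add: trie_inv_def n_def)
    then show ?thesis using True no n v by (auto simp: s'_sel \<phi>'_def)
  next
    case False
    then have x: "x \<in> nodes s" using x nodes' by simp
    show ?thesis
    proof (cases "x = v \<and> c = a")
      case True
      have "\<phi>' y \<noteq> w" if "y \<in> nodes s" for y using that w_new \<phi>_dom \<phi>'_old by metis
      moreover have "\<phi>' n = w" by (simp add: \<phi>'_def)
      moreover have "\<phi>' x @ [c] = w" using True v by (simp add: \<phi>'_old w_def)
      moreover have "edge s' (x, c) = Some n" using True by (simp add: s'_sel)
      ultimately show ?thesis unfolding nodes' by auto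
    next
      case no: False
      have "\<phi> x @ [c] \<noteq> w"
        using no x v bij unfolding w_def
        by (metis append1_eq_conv bij_betw_imp_inj_on inj_onD)
      then have "\<phi>' n \<noteq> \<phi>' x @ [c]" using \<phi>'_old[OF x] by (simp add: \<phi>'_def)
      moreover have "edge s' (x, c) = edge s (x, c)" using no by (auto simp: s'_sel)
      ultimately show ?thesis using edges[OF x, of c y] \<phi>'_old x n(1) unfolding nodes' by auto
    qed
  qed
  have stored': "stored s' x = primary_position (the (H' (\<phi>' x)))" if x: "x \<in> nodes s'" for x
  proof (cases "x = n")
    case True
    then show ?thesis using tr by (simp add: s'_sel \<phi>'_def H'_def trie_inv_def primary_position_def)
  next
    case False
    then have "x \<in> nodes s" "\<phi> x \<noteq> w" using x nodes' w_new \<phi>_dom by auto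
    then show ?thesis using tr n by (auto simp: s'_sel \<phi>'_old H'_def trie_inv_def)
  qed
  have pointers': "\<exists>y\<in>nodes s'. suffix_pointer s' x = Some y \<and> \<phi>' y = tl (\<phi>' x)"
    if x: "x \<in> nodes s' - {0}" "Some n \<noteq> Some x" for x
  proof (cases "lastcreatednode s = Some x")
    case True
    have "x \<in> nodes s" "0 < q" "\<phi> x = drop (q - 1) S @ [a]" using last[OF True] by auto
    \<comment> \<open>Nonemptiness makes the tail of \<open>drop (q - 1) S @ [a]\<close> remove a
      letter of \<open>S\<close> rather than the final \<open>a\<close>; the result is the label
      \<open>w\<close> of the new node.\<close>
    moreover have "tl (drop (q - 1) S) = drop q S" "drop (q - 1) S \<noteq> []"
      using tl_drop_pred[OF \<open>0 < q\<close>] \<open>0 < q\<close> q by simp_all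
    ultimately have "\<phi>' n = tl (\<phi>' x)" by (simp add: \<phi>'_old) (simp add: \<phi>'_def w_def)
    then show ?thesis using True by (auto simp: s'_sel sp_def nodes')
  next
    case False
    then have sp: "suffix_pointer s' x = suffix_pointer s x"
      by (auto simp: s'_sel sp_def split: option.splits)
    have "x \<in> nodes s - {0}" using x nodes' by auto
    then obtain y where "y \<in> nodes s" "suffix_pointer s x = Some y" "\<phi> y = tl (\<phi> x)"
      using tr False unfolding trie_inv_def by blast
    then show ?thesis using sp x nodes' \<phi>'_old by (intro bexI[of _ y]) auto
  qed
  have zero: "0 \<in> nodes s" using tr by (auto simp: trie_inv_def nodes_def)
  \<comment> \<open>The last created node has a nonempty label, so the root's pointer to \<bottom>
    is never overwritten.\<close>
  have "lastcreatednode s \<noteq> Some 0" using last[of 0] tr by (auto simp: trie_inv_def)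
  then have "suffix_pointer s' 0 = Some 1"
    using tr by (auto simp: s'_sel sp_def trie_inv_def split: option.splits)
  moreover have "v \<noteq> 1" "v < n" using v(1) by (auto simp: nodes_def n_def)
  ultimately have "trie_inv A (S @ [a]) (Suc q) H' \<phi>' (lastcreatednode s') s'"
    using cr' bij' edges' stored' pointers' tr n zero \<phi>'_old
    unfolding trie_inv_def by (simp add: s'_sel n_def)
  moreover have "if Suc q \<le> length S
      then \<exists>v\<in>nodes s'. currentnode s' = Some v \<and> \<phi>' v = drop (Suc q) S
      else currentnode s' = Some 1"
    using u(2) \<phi>'_old by (auto simp: s'_sel nodes' split: if_splits)
  moreover have "\<forall>l. lastcreatednode s' = Some l \<longrightarrow>
      l \<in> nodes s' \<and> 0 < Suc q \<and> \<phi>' l = drop (Suc q - 1) S @ [a]"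
    by (simp add: s'_sel nodes' \<phi>'_def w_def)
  ultimately have "while_inv A S a (Suc q) s'" unfolding while_inv_def using q by blast
  then show ?thesis using ex by blast
qed

text \<open>Amortization with potential \<open>9 * q\<close>: one test and a body of cost at most 8
  are paid by the increase of \<open>q\<close> by one, and the final failing test costs the extra
  unit. Termination follows because \<open>q\<close> cannot exceed
  \<open>Suc (length S)\<close>.\<close>

lemma while_loop:
  assumes "while_inv A S a q s" and "a \<in> A"
  shows "\<exists>t s' q'. exec (While (lacks_edge a) (while_body a)) s t s' \<and> while_inv A S a q' s' \<and>
    \<not> lacks_edge a s' \<and> t + 9 * q \<le> 9 * q' + 1"
  using assms(1)
proof (induction "Suc (length S) - q" arbitrary: q s rule: less_induct)
  case less
  show ?case
  proof (cases "lacks_edge a s")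
    case True
    obtain t s1 where s1: "exec (while_body a) s t s1" "t \<le> 8" "while_inv A S a (Suc q) s1"
      using while_body_step[OF less.prems True assms(2)] by blast
    have "Suc (length S) - Suc q < Suc (length S) - q"
      using s1(3) by (auto simp: while_inv_def)
    from less.hyps[OF this s1(3)] obtain t' s' q' where
      s': "exec (While (lacks_edge a) (while_body a)) s1 t' s'" "while_inv A S a q' s'"
      "\<not> lacks_edge a s'" "t' + 9 * Suc q \<le> 9 * q' + 1" by blast
    have "1 + t + t' + 9 * q \<le> 9 * q' + 1" using s1(2) s'(4) by simp
    then show ?thesis using exec.WhileTrue[OF True s1(1) s'(1)] s'(2,3) by blast
  next
    case False
    then show ?thesis using exec.WhileFalse[of "lacks_edge a" s] less.prems by (intro exI conjI) auto
  qed
qed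

section \<open>One iteration of the for-loop\<close>

text \<open>For changes confined to pointers and auxiliary variables, only the two suffix pointer
  clauses have to be proved again; the pending node may change from \<open>X\<close> to
  \<open>X'\<close>.\<close>

lemma trie_inv_congI:
  assumes "trie_inv A S q H \<phi> X s"
    and "next_node s' = next_node s" "edge s' = edge s" "stored s' = stored s"
      "root_node s' = root_node s" "bot_node s' = bot_node s" "currentsuffix s' = currentsuffix s"
    and "suffix_pointer s' 0 = Some 1"
    and "\<And>v. v \<in> nodes s - {0} \<Longrightarrow> X' \<noteq> Some v \<Longrightarrow>
      \<exists>u\<in>nodes s. suffix_pointer s' v = Some u \<and> \<phi> u = tl (\<phi> v)"
  shows "trie_inv A S q H \<phi> X' s'"
proof -
  have "nodes s' = nodes s" using assms(2) by (simp add: nodes_def)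
  then show ?thesis using assms unfolding trie_inv_def by simp
qed

text \<open>The constant 5 covers the reset of \<open>lastcreatednode\<close>, the final loop test,
  the move along the edge, the test of the conditional and the last pointer assignment.\<close>

lemma for_body_step:
  assumes inv: "for_inv A S q s" and a: "a \<in> A"
  shows "\<exists>t s' q'. exec (for_body a) s t s' \<and> for_inv A (S @ [a]) q' s' \<and>
    t + 9 * q \<le> 9 * q' + 5"
proof -
  define s0 where "s0 = s\<lparr>lastcreatednode := None\<rparr>"
  have nodes0: "nodes s0 = nodes s" by (simp add: nodes_def s0_def)
  obtain H \<phi> where "q \<le> length S" and tr0: "trie_inv A S q H \<phi> None s"
    and cur0: "\<exists>v\<in>nodes s. currentnode s = Some v \<and> \<phi> v = drop q S"
    using inv by (auto simp: for_inv_def)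
  have "trie_inv A S q H \<phi> None s0"
    by (rule trie_inv_congI[OF tr0]) (use tr0 in \<open>auto simp: s0_def trie_inv_def\<close>)
  \<comment> \<open>The string enters the invariant only through \<open>created\<close>, which is
    stable under appending.\<close>
  then have "trie_inv A (S @ [a]) q H \<phi> None s0"
    using created_append unfolding trie_inv_def by blast
  then have "while_inv A S a q s0"
    unfolding while_inv_def using \<open>q \<le> length S\<close> cur0 nodes0
    by (intro conjI exI[of _ H] exI[of _ \<phi>]) (auto simp: s0_def)
  from while_loop[OF this a] obtain t s1 q' where ex1: "exec (While (lacks_edge a) (while_body a)) s0 t s1"
    and inv1: "while_inv A S a q' s1" and stop: "\<not> lacks_edge a s1"
    and t: "t + 9 * q \<le> 9 * q' + 1"
    by blast
  obtain H \<phi> where tr: "trie_inv A (S @ [a]) q' H \<phi> (lastcreatednode s1) s1"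
    and cur: "if q' \<le> length S then \<exists>v\<in>nodes s1. currentnode s1 = Some v \<and> \<phi> v = drop q' S
         else currentnode s1 = Some 1"
    and last: "\<And>l. lastcreatednode s1 = Some l \<Longrightarrow>
       l \<in> nodes s1 \<and> 0 < q' \<and> \<phi> l = drop (q' - 1) S @ [a]"
    and q': "q' \<le> Suc (length S)"
    using inv1 unfolding while_inv_def by blast
  \<comment> \<open>Either an edge of the trie leads from \<open>drop q' S\<close> to
    \<open>drop q' S @ [a]\<close>, or \<bottom> leads to the root and
    \<open>drop q' (S @ [a])\<close> is empty.\<close>
  obtain v u where v: "currentnode s1 = Some v" "edge s1 (v, a) = Some u"
    and u: "u \<in> nodes s1" "\<phi> u = drop q' (S @ [a])"
  proof (cases "q' \<le> length S")
    case True
    then obtain v where "v \<in> nodes s1" "currentnode s1 = Some v" "\<phi> v = drop q' S"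
      using cur by auto
    moreover from this obtain u where "edge s1 (v, a) = Some u"
      using stop by (auto simp: lacks_edge_def)
    ultimately show ?thesis using that tr True unfolding trie_inv_def by simp
  next
    case False
    then show ?thesis using that[of 1 0] cur tr a q' by (auto simp: trie_inv_def nodes_def)
  qed
  define sp where "sp = (case lastcreatednode s1 of None \<Rightarrow> suffix_pointer s1
    | Some l \<Rightarrow> (suffix_pointer s1)(l \<mapsto> u))"
  define s' where "s' = s1\<lparr>currentnode := Some u, suffix_pointer := sp\<rparr>"
  have ex: "\<exists>t'. exec (for_body a) s t' s' \<and> t' + 9 * q \<le> 9 * q' + 5"
  proof (cases "lastcreatednode s1")
    case None
    have "exec (for_body a) s (Suc (t + Suc (1 + 0))) s'"
      unfolding for_body_def
      by (rule exec_Prim_Seq, simp, fold s0_def, rule exec.Seq[OF ex1], rule exec_Prim_Seq,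
          use v in simp, rule exec.CondFalse, use None in simp)
        (use None in \<open>simp add: s'_def sp_def exec.Skip\<close>)
    then show ?thesis using t by (intro exI conjI) auto
  next
    case (Some l)
    have "exec (for_body a) s (Suc (t + Suc (1 + Suc 0))) s'"
      unfolding for_body_def
      by (rule exec_Prim_Seq, simp, fold s0_def, rule exec.Seq[OF ex1], rule exec_Prim_Seq,
          use v in simp, rule exec.CondTrue, use Some in simp, rule exec_Prim)
        (use Some in \<open>simp add: s'_def sp_def\<close>)
    then show ?thesis using t by (intro exI conjI) auto
  qed
  have "trie_inv A (S @ [a]) q' H \<phi> None s'"
  proof (rule trie_inv_congI[OF tr])
    have "lastcreatednode s1 \<noteq> Some 0" using last[of 0] tr by (auto simp: trie_inv_def)
    then show "suffix_pointer s' 0 = Some 1"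
      using tr by (auto simp: s'_def sp_def trie_inv_def split: option.splits)
  next
    fix x assume x: "x \<in> nodes s1 - {0}"
    show "\<exists>u\<in>nodes s1. suffix_pointer s' x = Some u \<and> \<phi> u = tl (\<phi> x)"
    proof (cases "lastcreatednode s1 = Some x")
      case True
      have "0 < q'" "\<phi> x = drop (q' - 1) S @ [a]" using last[OF True] by auto
      \<comment> \<open>Valid also for \<open>q' = Suc (length S)\<close>: the label is then
        \<open>[a]\<close> and its pointer goes to the root.\<close>
      then have "\<phi> x = drop (q' - 1) (S @ [a])" using q' by simp
      then have "\<phi> u = tl (\<phi> x)" using u(2) tl_drop_pred[OF \<open>0 < q'\<close>] by metis
      then show ?thesis using True u(1) by (auto simp: s'_def sp_def)
    next
      case False
      then have "suffix_pointer s' x = suffix_pointer s1 x"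
        by (auto simp: s'_def sp_def split: option.splits)
      then show ?thesis using tr x False unfolding trie_inv_def by auto
    qed
  qed (auto simp: s'_def)
  moreover have "nodes s' = nodes s1" by (simp add: nodes_def s'_def)
  ultimately have "for_inv A (S @ [a]) q' s'"
    using u q' unfolding for_inv_def
    by (intro conjI exI[of _ H] exI[of _ \<phi>]) (auto simp: s'_def)
  then show ?thesis using ex by blast
qed

section \<open>Initialization and the complete run\<close>

lemma exec_bot_edges:
  assumes "root_node s = Some r" "bot_node s = Some b"
  shows "exec (foldr (;;)
       (map (\<lambda>a. Prim (\<lambda>s. do {r \<leftarrow> root_node s; b \<leftarrow> bot_node s;
                               Some (s\<lparr>edge := (edge s)((b, a) \<mapsto> r)\<rparr>)})) letters)
       Skip) s (length letters)
     (s\<lparr>edge := \<lambda>(x, c). if x = b \<and> c \<in> set letters then Some r else edge s (x, c)\<rparr>)"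
  using assms
proof (induction letters arbitrary: s)
  case Nil
  then show ?case by (simp add: exec.Skip)
next
  case (Cons a letters)
  let ?s = "s\<lparr>edge := (edge s)((b, a) \<mapsto> r)\<rparr>"
  have "(\<lambda>(x, c). if x = b \<and> c \<in> set letters then Some r else edge ?s (x, c)) =
      (\<lambda>(x, c). if x = b \<and> c \<in> set (a # letters) then Some r else edge s (x, c))"
    by (auto simp: fun_eq_iff)
  then show ?case using Cons.IH[of ?s] Cons.prems by (auto intro!: exec_Prim_Seq simp del: fun_upd_apply)
qed

lemma initialize_for_inv:
  "\<exists>s. exec (initialize letters) start_state (length letters + 5) s \<and> for_inv (set letters) [] 0 s"
proof -
  define s :: "'a state" where
    "s = \<lparr>next_node = 2, edge = (\<lambda>(x, c). if x = 1 \<and> c \<in> set letters then Some 0 else None),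
      suffix_pointer = [0 \<mapsto> 1], stored = Map.empty,
      root_node = Some 0, bot_node = Some 1, currentnode = Some 0, newnode = None,
      lastcreatednode = None, currentsuffix = 1\<rparr>"
  have "exec (initialize letters) start_state
      (Suc (Suc (Suc (length letters + Suc (Suc 0))))) s"
    unfolding initialize_def
    by (rule exec_Prim_Seq, simp, rule exec_Prim_Seq, simp, rule exec_Prim_Seq,
        simp add: start_state_def, rule exec.Seq, rule exec_bot_edges, simp, simp,
        rule exec_Prim_Seq, simp, rule exec_Prim)
      (simp add: start_state_def s_def fun_eq_iff)
  moreover have "nodes s = {0}" by (auto simp: nodes_def s_def)
  then have "trie_inv (set letters) [] 0 [[] \<mapsto> {}] (\<lambda>_. []) None s"
    unfolding trie_inv_def
    by (auto simp: s_def created_0 primary_position_def bij_betw_def)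
  then have "for_inv (set letters) [] 0 s"
    unfolding for_inv_def using \<open>nodes s = {0}\<close>
    by (intro conjI exI[of _ "[[] \<mapsto> {}]"] exI[of _ "\<lambda>_. []"]) (auto simp: s_def)
  ultimately show ?thesis by (auto simp: eval_nat_numeral)
qed

text \<open>Summing the amortized costs telescopes the potential \<open>9 * q\<close>; each
  iteration adds 5 for its body and 1 for the control of the for-loop.\<close>

lemma after_iteration_for_inv:
  assumes "set T \<subseteq> set letters" "k \<le> length T"
  shows "\<exists>t s q. after_iteration letters T k t s \<and> for_inv (set letters) (take k T) q s \<and>
    t \<le> length letters + 5 + 9 * q + 6 * k"
  using assms(2)
proof (induction k)
  case 0
  obtain s where "exec (initialize letters) start_state (length letters + 5) s"
    "for_inv (set letters) [] 0 s" using initialize_for_inv by blast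
  then show ?case
    by (intro exI[of _ "length letters + 5"] exI[of _ s] exI[of _ 0])
      (auto intro: after_iteration.intros)
next
  case (Suc k)
  then obtain t s q where IH: "after_iteration letters T k t s"
    "for_inv (set letters) (take k T) q s" "t \<le> length letters + 5 + 9 * q + 6 * k" by auto
  have k: "k < length T" using Suc.prems by simp
  then have "T ! k \<in> set letters" using assms(1) nth_mem by blast
  then obtain t' s' q' where s': "exec (for_body (T ! k)) s t' s'"
    "for_inv (set letters) (take k T @ [T ! k]) q' s'" "t' + 9 * q \<le> 9 * q' + 5"
    using for_body_step[OF IH(2)] by blast
  have "after_iteration letters T (Suc k) (t + 1 + t') s'"
    using after_iteration.intros(2)[OF IH(1) k s'(1)] by simp
  moreover have "for_inv (set letters) (take (Suc k) T) q' s'"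
    using s'(2) k by (simp add: take_Suc_conv_app_nth)
  moreover have "t + 1 + t' \<le> length letters + 5 + 9 * q' + 6 * Suc k"
    using IH(3) s'(3) by simp
  ultimately show ?case by blast
qed

theorem theorem2:
  fixes \<sigma> :: nat
  shows "(\<forall>(A :: 'a set) letters T k.
            finite A \<and> card A = \<sigma> \<and> distinct letters \<and> set letters = A \<and> set T \<subseteq> A \<and>
            k \<in> {1..length T} \<longrightarrow>
              (\<exists>t s. after_iteration letters T k t s) \<and>
              (\<forall>t s. after_iteration letters T k t s \<longrightarrow>
                       represents_position_heap s (take k T))) \<and>
         (\<exists>C :: nat. \<forall>(A :: 'a set) letters T.
            finite A \<and> card A = \<sigma> \<and> distinct letters \<and> set letters = A \<and> set T \<subseteq> A \<longrightarrow>
              (\<exists>t. halts_after letters T t) \<and>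
              (\<forall>t. halts_after letters T t \<and> length T \<ge> 1 \<longrightarrow> t \<le> C * length T))"
proof (intro conjI exI[of _ "\<sigma> + 21"]; intro allI impI)
  fix A :: "'a set" and letters T k
  assume asm: "finite A \<and> card A = \<sigma> \<and> distinct letters \<and> set letters = A \<and> set T \<subseteq> A \<and>
    k \<in> {1..length T}"
  then obtain t s q where run: "after_iteration letters T k t s"
    "for_inv (set letters) (take k T) q s"
    using after_iteration_for_inv[of T letters k] by (metis atLeastAtMost_iff)
  then have "represents_position_heap s' (take k T)" if "after_iteration letters T k t' s'" for t' s'
    using after_iteration_deterministic[OF run(1) that] for_inv_represents by blast
  then show "(\<exists>t s. after_iteration letters T k t s) \<and>
      (\<forall>t s. after_iteration letters T k t s \<longrightarrow> represents_position_heap s (take k T))"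
    using run(1) by blast
next
  fix A :: "'a set" and letters T
  assume asm: "finite A \<and> card A = \<sigma> \<and> distinct letters \<and> set letters = A \<and> set T \<subseteq> A"
  then obtain t s q where run: "after_iteration letters T (length T) t s"
    "for_inv (set letters) T q s" "t \<le> length letters + 5 + 9 * q + 6 * length T"
    using after_iteration_for_inv[of T letters "length T"] by (metis order_refl take_all)
  have "t' \<le> (\<sigma> + 21) * length T" if t': "halts_after letters T t'" "1 \<le> length T" for t'
  proof -
    have "t' = t + 1"
      using t'(1) after_iteration_deterministic[OF run(1)] by (auto simp: halts_after_def)
    moreover have "q \<le> length T" using run(2) by (simp add: for_inv_def)
    moreover have "length letters = \<sigma>" using asm distinct_card by fastforce
    \<comment> \<open>The 6 consists of 5 units of initialization and one for leaving the loop; the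
      15 is 9 + 6 with \<open>q \<le> length T\<close>. As \<open>length T\<close> is at least 1,
      the additive part is absorbed, giving the factor \<open>\<sigma> + 21\<close>.\<close>
    ultimately have "t' \<le> (\<sigma> + 6) * 1 + 15 * length T" using run(3) by simp
    also have "\<dots> \<le> (\<sigma> + 6) * length T + 15 * length T"
      using t'(2) by (intro add_mono mult_le_mono) auto
    finally show ?thesis by (simp add: algebra_simps)
  qed
  then show "(\<exists>t. halts_after letters T t) \<and>
      (\<forall>t. halts_after letters T t \<and> length T \<ge> 1 \<longrightarrow> t \<le> (\<sigma> + 21) * length T)"
    using run(1) by (auto simp: halts_after_def)
qed

end
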